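(* Every topological group of cardinality strictly less than $\mathfrak c$ (the cardinality of the continuum) is TAP.
   Context: All topological groups are Hausdorff; $\mathbb N=\{0,1,2,\dots\}$. Products are ordered: $\prod_{n=0}^m b_n=b_0b_1\cdots b_m$. A sequence $\{b_n:n\in\mathbb N\}$ in a topological group $G$ is productive if $\{\prod_{n=0}^m b_n:m\in\mathbb N\}$ converges to some element of $G$. A sequence $\{a_n:n\in\mathbb N\}$ in $G$ is $f_\omega$-productive if it is faithfully indexed ($a_n\ne a_m$ for $n\neq m$) and $\{a_n^{z(n)}:n\in\mathbb N\}$ is productive for every function $z:\mathbb N\to\mathbb Z$. It is unconditionally $f_\omega$-productive if it is faithfully indexed and $\{a_{\varphi(n)}:n\in\mathbb N\}$ is $f_\omega$-productive for every bijection $\varphi:\mathbb N\to\mathbb N$. A topological group is TAP if it contains no unconditionally $f_\omega$-productive sequence. *)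

theory Defs
  imports "HOL-Analysis.Analysis" "HOL-Algebra.Group"
begin

text \<open>Topological groups are Hausdorff by convention.\<close>

locale topological_group = group G for G (structure) +
  fixes T :: "'a topology"
  assumes topspace_eq_carrier: "topspace T = carrier G"
    and Hausdorff: "Hausdorff_space T"
    and continuous_mult: "continuous_map (prod_topology T T) T (\<lambda>(x, y). x \<otimes> y)"
    and continuous_inv: "continuous_map T T (\<lambda>x. inv x)"

text \<open>The group need not be abelian, so the product \<open>b 0 \<otimes> b 1 \<otimes> \<dots> \<otimes> b m\<close> is taken in this order
  (\<open>finprod\<close> requires commutativity).\<close>

primrec ordered_prod :: "('a, 'b) monoid_scheme \<Rightarrow> (nat \<Rightarrow> 'a) \<Rightarrow> nat \<Rightarrow> 'a" where
  "ordered_prod G b 0 = b 0"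
| "ordered_prod G b (Suc m) = ordered_prod G b m \<otimes>\<^bsub>G\<^esub> b (Suc m)"

definition productive ::
    "('a, 'b) monoid_scheme \<Rightarrow> 'a topology \<Rightarrow> (nat \<Rightarrow> 'a) \<Rightarrow> bool" where
  "productive G T b \<longleftrightarrow>
     range b \<subseteq> carrier G \<and>
     (\<exists>l\<in>carrier G. limitin T (\<lambda>m. ordered_prod G b m) l sequentially)"

definition f_omega_productive ::
    "('a, 'b) monoid_scheme \<Rightarrow> 'a topology \<Rightarrow> (nat \<Rightarrow> 'a) \<Rightarrow> bool" where
  "f_omega_productive G T a \<longleftrightarrow>
     range a \<subseteq> carrier G \<and> inj a \<and>
     (\<forall>z :: nat \<Rightarrow> int. productive G T (\<lambda>n. a n [^]\<^bsub>G\<^esub> z n))"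

definition unconditionally_f_omega_productive ::
    "('a, 'b) monoid_scheme \<Rightarrow> 'a topology \<Rightarrow> (nat \<Rightarrow> 'a) \<Rightarrow> bool" where
  "unconditionally_f_omega_productive G T a \<longleftrightarrow>
     range a \<subseteq> carrier G \<and> inj a \<and>
     (\<forall>\<phi> :: nat \<Rightarrow> nat. bij \<phi> \<longrightarrow> f_omega_productive G T (\<lambda>n. a (\<phi> n)))"

definition TAP :: "('a, 'b) monoid_scheme \<Rightarrow> 'a topology \<Rightarrow> bool" where
  "TAP G T \<longleftrightarrow> \<not> (\<exists>a. unconditionally_f_omega_productive G T a)"

end

theory Submission
  imports Defs
begin

text \<open>
  Only exponents 0 and 1 are needed: a set \<open>S\<close> of naturals yields the limit of the product of the
  \<open>a n\<close> with \<open>n \<in> S\<close>. Since blocks taken from different sets can be concatenated into a single set,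
  whose product satisfies the Cauchy condition, the blocks beyond \<open>N\<close> lie in a prescribed
  neighbourhood of the identity for some \<open>N\<close>, uniformly over all sets. Hence one can pick a sparse
  sequence \<open>t\<close> such that no quotient of two products beyond \<open>t (k + 1)\<close> comes close to
  \<open>a (t k)\<close>. After cancelling the common initial part, two different subsets of the range of \<open>t\<close>
  thus have different limits, so that the group has at least continuum many elements.
\<close>

section \<open>Limits and neighbourhoods of the identity in a topological group\<close>

context topological_group
begin

lemma continuous_map_div: "continuous_map (prod_topology T T) T (\<lambda>(x, y). x \<otimes> inv y)"
proof -
  have "continuous_map (prod_topology T T) (prod_topology T T) (\<lambda>z. (fst z, inv (snd z)))"
    using continuous_map_compose[OF continuous_map_snd continuous_inv]
    by (simp add: continuous_map_paired continuous_map_fst o_def)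
  from continuous_map_compose[OF this continuous_mult] show ?thesis
    by (simp add: o_def case_prod_unfold)
qed

lemma limitin_mult:
  assumes "limitin T f x F" "limitin T g y F"
  shows "limitin T (\<lambda>i. f i \<otimes> g i) (x \<otimes> y) F"
proof -
  have "limitin (prod_topology T T) (\<lambda>i. (f i, g i)) (x, y) F"
    using assms by (simp add: limitin_pairwise o_def)
  from continuous_map_limit[OF continuous_mult this] show ?thesis
    by (simp add: o_def)
qed

lemma limitin_inv:
  assumes "limitin T f x F"
  shows "limitin T (\<lambda>i. inv f i) (inv x) F"
  using continuous_map_limit[OF continuous_inv assms] by (simp add: o_def)

lemma ex_nhd_div_subset:
  assumes "openin T B" "\<one> \<in> B"
  obtains W where "openin T W" "\<one> \<in> W" "\<And>x y. x \<in> W \<Longrightarrow> y \<in> W \<Longrightarrow> x \<otimes> inv y \<in> B"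
proof -
  let ?P = "{z \<in> topspace (prod_topology T T). (case z of (x, y) \<Rightarrow> x \<otimes> inv y) \<in> B}"
  have "openin (prod_topology T T) ?P"
    using continuous_map_div assms(1) by (rule openin_continuous_map_preimage)
  moreover have "(\<one>, \<one>) \<in> ?P"
    using assms(2) by (simp add: topspace_eq_carrier)
  ultimately obtain U V where "openin T U" "openin T V" "\<one> \<in> U" "\<one> \<in> V" "U \<times> V \<subseteq> ?P"
    unfolding openin_prod_topology_alt by meson
  then show thesis
    by (intro that[of "U \<inter> V"]) auto
qed

end

section \<open>Products and blocks along a set of indices\<close>

primrec subset_prod :: "('a, 'b) monoid_scheme \<Rightarrow> (nat \<Rightarrow> 'a) \<Rightarrow> nat set \<Rightarrow> nat \<Rightarrow> 'a" where
  "subset_prod G a S 0 = \<one>\<^bsub>G\<^esub>"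
| "subset_prod G a S (Suc n) = subset_prod G a S n \<otimes>\<^bsub>G\<^esub> (if n \<in> S then a n else \<one>\<^bsub>G\<^esub>)"

text \<open>For \<open>m \<le> n\<close> and terms in the carrier, this is the ordered product of
  the \<open>a i\<close> with \<open>i \<in> S\<close> and \<open>m \<le> i < n\<close>. The
  quotient form lets limits of blocks follow from limits of \<open>subset_prod\<close> by
  continuity.\<close>

definition subset_block ::
    "('a, 'b) monoid_scheme \<Rightarrow> (nat \<Rightarrow> 'a) \<Rightarrow> nat set \<Rightarrow> nat \<Rightarrow> nat \<Rightarrow> 'a" where
  "subset_block G a S m n = inv\<^bsub>G\<^esub> (subset_prod G a S m) \<otimes>\<^bsub>G\<^esub> subset_prod G a S n"

context group
begin

lemma subset_prod_closed [simp]: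
  "range a \<subseteq> carrier G \<Longrightarrow> subset_prod G a S n \<in> carrier G"
  by (induction n) auto

text \<open>The shift arises because \<open>ordered_prod\<close> includes its last index while
  \<open>subset_prod\<close> stops before it.\<close>

lemma ordered_prod_eq_subset_prod:
  assumes "range a \<subseteq> carrier G"
  shows "ordered_prod G (\<lambda>n. a n [^] (if n \<in> S then 1 else 0 :: int)) m = subset_prod G a S (Suc m)"
proof -
  have "a n \<in> carrier G" for n
    using assms by auto
  then show ?thesis
    by (induction m) (auto simp: int_pow_1)
qed

lemma subset_block_closed [simp]:
  "range a \<subseteq> carrier G \<Longrightarrow> subset_block G a S m n \<in> carrier G"
  by (simp add: subset_block_def)

lemma subset_block_self [simp]:
  "range a \<subseteq> carrier G \<Longrightarrow> subset_block G a S m m = \<one>"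
  by (simp add: subset_block_def)

lemma subset_block_Suc:
  assumes "range a \<subseteq> carrier G"
  shows "subset_block G a S m (Suc n) = subset_block G a S m n \<otimes> (if n \<in> S then a n else \<one>)"
proof -
  have "a n \<in> carrier G"
    using assms by auto
  then show ?thesis
    using assms by (simp add: subset_block_def m_assoc)
qed

lemma subset_prod_mult_block:
  assumes "range a \<subseteq> carrier G"
  shows "subset_prod G a S m \<otimes> subset_block G a S m n = subset_prod G a S n"
  using assms by (simp add: subset_block_def m_assoc[symmetric])

lemma subset_block_cong:
  assumes "range a \<subseteq> carrier G" "m \<le> n" "\<And>i. m \<le> i \<Longrightarrow> i < n \<Longrightarrow> i \<in> S \<longleftrightarrow> i \<in> S'"
  shows "subset_block G a S m n = subset_block G a S' m n"
  using assms(2,3)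
proof (induction n rule: dec_induct)
  case base
  then show ?case
    using assms(1) by simp
next
  case (step n)
  then have "subset_block G a S m n = subset_block G a S' m n" "n \<in> S \<longleftrightarrow> n \<in> S'"
    by auto
  then show ?case
    using assms(1) by (simp add: subset_block_Suc)
qed

lemma subset_prod_cong:
  assumes "range a \<subseteq> carrier G" "\<And>i. i < n \<Longrightarrow> i \<in> S \<longleftrightarrow> i \<in> S'"
  shows "subset_prod G a S n = subset_prod G a S' n"
  using subset_block_cong[OF assms(1), of 0 n S S'] assms by (simp add: subset_block_def)

lemma subset_prod_gap:
  assumes "range a \<subseteq> carrier G" "m \<le> n" "\<And>i. m \<le> i \<Longrightarrow> i < n \<Longrightarrow> i \<notin> S"
  shows "subset_prod G a S n = subset_prod G a S m"
  using assms(2,3) by (induction n rule: dec_induct) (use assms(1) in auto)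

end

section \<open>Convergence and uniform smallness of blocks\<close>

lemma (in topological_group) f_omega_productive_subset_limit:
  assumes "f_omega_productive G T a"
  shows "\<exists>l. limitin T (subset_prod G a S) l sequentially"
proof -
  have a: "range a \<subseteq> carrier G"
    using assms by (simp add: f_omega_productive_def)
  obtain l where
    "limitin T (ordered_prod G (\<lambda>n. a n [^] (if n \<in> S then 1 else 0 :: int))) l sequentially"
    using assms unfolding f_omega_productive_def productive_def by meson
  then have "limitin T (\<lambda>m. subset_prod G a S (m + 1)) l sequentially"
    unfolding Suc_eq_plus1[symmetric] ordered_prod_eq_subset_prod[OF a, symmetric] .
  then show ?thesis
    by (intro exI) (rule limitin_sequentially_offset_rev)
qed

text \<open>Otherwise a block outside \<open>U\<close> starts at every \<open>N > m\<close>.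
  Chaining such blocks end to end gives one set whose partial products converge but violate the
  Cauchy condition.\<close>

lemma (in topological_group) subset_blocks_uniformly_small:
  assumes a: "range a \<subseteq> carrier G"
    and lim: "\<And>S. \<exists>l. limitin T (subset_prod G a S) l sequentially"
    and U: "openin T U" "\<one> \<in> U"
  obtains N where "m < N" "\<And>S n. N \<le> n \<Longrightarrow> subset_block G a S N n \<in> U"
proof (rule ccontr)
  assume "\<not> thesis"
  with that have "\<forall>N. \<exists>S n. m < N \<longrightarrow> N \<le> n \<and> subset_block G a S N n \<notin> U"
    by blast
  then obtain Q j where j: "\<And>N. m < N \<Longrightarrow> N \<le> j N"
    and Q: "\<And>N. m < N \<Longrightarrow> subset_block G a (Q N) N (j N) \<notin> U"
    by metis
  \<comment> \<open>An empty block equals \<open>\<one>\<close>, which lies in \<open>U\<close>, so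
    a bad block has positive length.\<close>
  have j_less: "N < j N" if "m < N" for N
    using Q[OF that] j[OF that] U(2) a by (cases "j N = N") auto
  \<comment> \<open>Each bad block starts where the previous one ends.\<close>
  define r where "r i = (j ^^ i) (Suc m)" for i
  have r_Suc: "r (Suc i) = j (r i)" for i
    by (simp add: r_def)
  have r_gt: "m < r i" for i
  proof (induction i)
    case (Suc i)
    then show ?case
      using j_less[of "r i"] by (simp add: r_Suc)
  qed (simp add: r_def)
  have r: "strict_mono r"
    by (rule strict_monoI_Suc) (simp add: r_Suc j_less r_gt)
  define S where "S = (\<Union>i. Q (r i) \<inter> {r i..<r (Suc i)})"
  have S_iff: "n \<in> S \<longleftrightarrow> n \<in> Q (r i)" if n: "r i \<le> n" "n < r (Suc i)" for i n
  proof
    assume "n \<in> S"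
    then obtain k where k: "n \<in> Q (r k)" "r k \<le> n" "n < r (Suc k)"
      by (auto simp: S_def)
    then have "r k < r (Suc i)" "r i < r (Suc k)"
      using n by auto
    then have "k = i"
      by (simp add: strict_mono_less[OF r])
    with k(1) show "n \<in> Q (r i)"
      by simp
  next
    assume "n \<in> Q (r i)"
    with n show "n \<in> S"
      by (auto simp: S_def)
  qed
  have block: "subset_block G a S (r i) (r (Suc i)) \<notin> U" for i
  proof -
    have "r i \<le> r (Suc i)"
      using j[OF r_gt] by (simp only: r_Suc)
    then have "subset_block G a S (r i) (r (Suc i)) = subset_block G a (Q (r i)) (r i) (r (Suc i))"
      using S_iff by (rule subset_block_cong[OF a])
    then show ?thesis
      using Q[OF r_gt] by (simp only: r_Suc) simp
  qed
  obtain l where l: "limitin T (subset_prod G a S) l sequentially"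
    using lim by blast
  have sub: "limitin T (\<lambda>i. subset_prod G a S (r i)) l sequentially"
    using limitin_subsequence[OF r l] by (simp add: o_def)
  \<comment> \<open>Both ends of the block run through partial products with the same limit
    \<open>l\<close>, so the blocks tend to \<open>\<one>\<close>.\<close>
  have "limitin T (\<lambda>i. subset_block G a S (r i) (r (i + 1))) (inv l \<otimes> l) sequentially"
    unfolding subset_block_def
    by (intro limitin_mult limitin_inv sub limitin_sequentially_offset[OF sub])
  moreover have "l \<in> carrier G"
    using l by (simp add: limitin_def topspace_eq_carrier)
  ultimately show False
    using U block by (auto simp: limitin_sequentially)
qed

text \<open>Disjoint neighbourhoods separate \<open>x\<close> from \<open>\<one>\<close>, and late
  blocks are so small that all their quotients stay near \<open>\<one>\<close>. What matters is that
  \<open>N\<close> is independent of \<open>S\<close> and \<open>S'\<close>.\<close>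

lemma (in topological_group) ex_block_quotient_separation:
  assumes a: "range a \<subseteq> carrier G"
    and lim: "\<And>S. \<exists>l. limitin T (subset_prod G a S) l sequentially"
    and x: "x \<in> carrier G" "x \<noteq> \<one>"
  obtains N where "m < N"
    "\<And>S S'. \<not> limitin T (\<lambda>n. subset_block G a S N n \<otimes> inv (subset_block G a S' N n)) x sequentially"
proof -
  obtain A B where AB: "openin T A" "openin T B" "x \<in> A" "\<one> \<in> B" "disjnt A B"
    using Hausdorff x unfolding Hausdorff_space_def topspace_eq_carrier by (metis one_closed)
  obtain W where W: "openin T W" "\<one> \<in> W"
    "\<And>x y. x \<in> W \<Longrightarrow> y \<in> W \<Longrightarrow> x \<otimes> inv y \<in> B"
    using ex_nhd_div_subset[OF AB(2,4)] by blast
  obtain N where N: "m < N" "\<And>S n. N \<le> n \<Longrightarrow> subset_block G a S N n \<in> W"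
    using subset_blocks_uniformly_small[OF a lim W(1,2)] by blast
  have "\<not> limitin T (\<lambda>n. subset_block G a S N n \<otimes> inv (subset_block G a S' N n)) x sequentially" for S S'
  proof
    assume "limitin T (\<lambda>n. subset_block G a S N n \<otimes> inv (subset_block G a S' N n)) x sequentially"
    then obtain M where M: "\<And>n. M \<le> n \<Longrightarrow>
        subset_block G a S N n \<otimes> inv (subset_block G a S' N n) \<in> A"
      using AB(1,3) unfolding limitin_sequentially by blast
    have "subset_block G a S N (max M N) \<otimes> inv (subset_block G a S' N (max M N)) \<in> A \<inter> B"
      using M W(3) N(2) by simp
    then show False
      using AB(5) by (auto simp: disjnt_def)
  qed
  with N(1) show thesis
    by (rule that)
qed

section \<open>Embedding the power set of the naturals into the group\<close>

lemma (in topological_group) nat_sets_lepoll_carrier: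
  assumes a: "range a \<subseteq> carrier G" and "inj a"
    and lim: "\<And>S. \<exists>l. limitin T (subset_prod G a S) l sequentially"
  shows "(UNIV :: nat set set) \<lesssim> carrier G"
proof -
  \<comment> \<open>Separation requires \<open>a k \<noteq> \<one>\<close>, so the indices start
    beyond any occurrence of \<open>\<one>\<close>.\<close>
  have "finite (a -` {\<one>})"
    using \<open>inj a\<close> by (intro finite_vimageI) auto
  then obtain n0 where "a -` {\<one>} \<subseteq> {..<n0}"
    using finite_nat_iff_bounded by blast
  then have n0: "a n \<noteq> \<one>" if "n0 \<le> n" for n
    using that by (auto simp: subset_iff leD)
  have "\<exists>N>k. n0 \<le> k \<longrightarrow> (\<forall>S S'.
      \<not> limitin T (\<lambda>n. subset_block G a S N n \<otimes> inv (subset_block G a S' N n)) (a k) sequentially)" for k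
  proof (cases "n0 \<le> k")
    case True
    have "a k \<in> carrier G"
      using a by auto
    then show ?thesis
      using ex_block_quotient_separation[OF a lim _ n0[OF True], of k] by metis
  qed auto
  then obtain N where N_gt: "\<And>k. k < N k"
    and N: "\<And>k S S'. n0 \<le> k \<Longrightarrow> \<not> limitin T
      (\<lambda>n. subset_block G a S (N k) n \<otimes> inv (subset_block G a S' (N k) n)) (a k) sequentially"
    by metis
  \<comment> \<open>Each index of \<open>t\<close> lies at the separation threshold of its
    predecessor.\<close>
  define t where "t i = (N ^^ i) n0" for i
  have t_Suc: "t (Suc i) = N (t i)" for i
    by (simp add: t_def)
  have t: "strict_mono t"
    by (rule strict_monoI_Suc) (simp add: t_Suc N_gt)
  have t_ge: "n0 \<le> t i" for i
    using strict_mono_less_eq[OF t, of 0 i] by (simp add: t_def)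
  have t_mem: "t i \<in> t ` X \<longleftrightarrow> i \<in> X" for i X
    using strict_mono_imp_inj_on[OF t] by (simp add: inj_image_mem_iff)
  obtain L where L: "\<And>S. limitin T (subset_prod G a S) (L S) sequentially"
    using lim by metis
  have L_closed [simp]: "L S \<in> carrier G" for S
    using L[of S] by (simp add: limitin_def topspace_eq_carrier)
  \<comment> \<open>At the first difference \<open>i\<close>, one product picks up
    \<open>a (t i)\<close> and the other does not. Equal limits would make a quotient of later
    blocks tend to \<open>a (t i)\<close>.\<close>
  have first_difference: False
    if eq: "L (t ` X) = L (t ` Y)" and i: "i \<in> X" "i \<notin> Y" and less: "\<And>k. k < i \<Longrightarrow> k \<in> X \<longleftrightarrow> k \<in> Y"
    for X Y i
  proof -
    let ?S = "t ` X" and ?S' = "t ` Y" and ?M = "t (Suc i)"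
    define g where "g = subset_prod G a ?S (t i)"
    have ai: "a (t i) \<in> carrier G" and g: "g \<in> carrier G"
      using a by (auto simp: g_def)
    have g': "subset_prod G a ?S' (t i) = g"
      unfolding g_def using less
      by (intro subset_prod_cong[OF a]) (auto simp: strict_mono_less[OF t])
    \<comment> \<open>No value of \<open>t\<close> lies strictly between \<open>t i\<close> and
      \<open>?M\<close>, so up to \<open>?M\<close> the two products differ only by the factor
      \<open>a (t i)\<close>.\<close>
    have gap: "k \<notin> t ` Z" if "Suc (t i) \<le> k" "k < ?M" for k Z
    proof
      assume "k \<in> t ` Z"
      then obtain c where "k = t c"
        by blast
      then have "i < c" "c < Suc i"
        using that strict_mono_less[OF t] by (simp_all add: Suc_le_eq)
      then show False
        by simp
    qed
    have M: "Suc (t i) \<le> ?M"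
      using N_gt by (simp add: t_Suc Suc_le_eq)
    have S: "subset_prod G a ?S ?M = g \<otimes> a (t i)"
      using subset_prod_gap[OF a M gap] i t_mem by (simp add: g_def)
    have S': "subset_prod G a ?S' ?M = g"
      using subset_prod_gap[OF a M gap] i t_mem g g' by simp
    \<comment> \<open>With the block of \<open>?S'\<close> in front, the equal limits meet in the
      middle and cancel; then \<open>inv g\<close> cancels against \<open>g\<close>, leaving
      \<open>a (t i)\<close>.\<close>
    have "limitin T (\<lambda>n. subset_block G a ?S' ?M n \<otimes> inv (subset_block G a ?S ?M n))
        ((inv g \<otimes> L ?S') \<otimes> inv (inv (g \<otimes> a (t i)) \<otimes> L ?S)) sequentially"
      unfolding subset_block_def S S'
      by (intro limitin_mult limitin_inv L) (use g ai in \<open>simp_all add: topspace_eq_carrier\<close>)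
    moreover have "(inv g \<otimes> L ?S') \<otimes> inv (inv (g \<otimes> a (t i)) \<otimes> L ?S) = a (t i)"
    proof -
      have "x \<otimes> (inv x \<otimes> y) = y" "inv x \<otimes> (x \<otimes> y) = y" if "x \<in> carrier G" "y \<in> carrier G" for x y
        using that by (simp_all add: m_assoc[symmetric])
      then show ?thesis
        using g ai by (simp add: eq inv_mult_group m_assoc)
    qed
    ultimately show False
      using N[OF t_ge[of i]] by (simp add: t_Suc)
  qed
  have "X = Y" if eq: "L (t ` X) = L (t ` Y)" for X Y
  proof (rule ccontr)
    assume "X \<noteq> Y"
    then have "\<exists>i. (i \<in> X) \<noteq> (i \<in> Y)"
      by blast
    then obtain i where "(i \<in> X) \<noteq> (i \<in> Y)" "\<And>k. k < i \<Longrightarrow> (k \<in> X) = (k \<in> Y)"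
      using exists_least_iff[of "\<lambda>i. (i \<in> X) \<noteq> (i \<in> Y)"] by blast
    \<comment> \<open>The least difference may belong to either set, hence both orders of
      \<open>X\<close> and \<open>Y\<close>.\<close>
    then show False
      using first_difference[of X Y i] first_difference[of Y X i] eq by metis
  qed
  then have "inj (\<lambda>X. L (t ` X))"
    by (rule injI)
  then show ?thesis
    unfolding lepoll_def by (intro exI[of _ "\<lambda>X. L (t ` X)"]) auto
qed

theorem corollary8p5:
  fixes G :: "('a, 'b) monoid_scheme" and T :: "'a topology"
  assumes "topological_group G T"
    and "carrier G \<prec> (UNIV :: real set)"
  shows "TAP G T"
  unfolding TAP_def
proof
  interpret topological_group G T
    by fact
  assume "\<exists>a. unconditionally_f_omega_productive G T a"
  then obtain a where "unconditionally_f_omega_productive G T a" ..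
  then have "f_omega_productive G T (\<lambda>n. a (id n))"
    unfolding unconditionally_f_omega_productive_def using bij_id by blast
  then have f: "f_omega_productive G T a"
    by simp
  then have "range a \<subseteq> carrier G" "inj a"
    by (auto simp: f_omega_productive_def)
  then have "(UNIV :: nat set set) \<lesssim> carrier G"
    by (rule nat_sets_lepoll_carrier) (rule f_omega_productive_subset_limit[OF f])
  also note assms(2)
  also have "(UNIV :: real set) \<approx> (UNIV :: nat set set)"
    by (rule eqpoll_sym[OF nat_sets_eqpoll_reals])
  finally show False
    by simp
qed

end
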